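(* The function $\sigma_3(z)$ has the Taylor expansion $$\sigma_3(z) = \theta_3(1)\sum_{n=0}^\infty \frac{d(n)}{(2n)!}\,\Phi^n z^{2n}\qquad (|z|<1),$$ where $\Phi = \dfrac{\Omega}{4} = \dfrac{\Gamma(1/4)^8}{128\pi^4}$.
   Context: The Jacobi theta constant is $\theta_3(x)=\sum_{n=-\infty}^\infty e^{-\pi n^2 x}$ for $\operatorname{Re}(x)>0$. The function $\sigma_3$ is defined on the unit disk by $\sigma_3(z)=\dfrac{1}{\sqrt{1+z}}\,\theta_3\!\left(\dfrac{1-z}{1+z}\right)$ for $|z|<1$ (principal square root). Let $\Omega=\dfrac{\Gamma(1/4)^8}{32\pi^4}$, where $\Gamma$ is the Euler gamma function. The sequence $(d(n))_{n=0}^\infty = 1,1,-1,51,849,-26199,1341999,\ldots$ is the (unique) sequence of integers with the property that for all $n\ge 0$, $$\theta_3^{(n)}(1) = \theta_3(1)\cdot \frac{(-1)^n}{4^n}\sum_{k=0}^{\lfloor n/2\rfloor} \frac{(2n)!}{2^{n-2k}\,(4k)!\,(n-2k)!}\, d(k)\,\Omega^k .$$ *)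

theory Defs
  imports "HOL-Complex_Analysis.Complex_Analysis"
begin

text \<open>Only the values on the half-plane \<open>Re x > 0\<close> are meaningful: elsewhere the family is not
  summable and \<^const>\<open>infsum\<close> returns a default value.\<close>

definition theta3 :: "complex \<Rightarrow> complex"
  where "theta3 x = (\<Sum>\<^sub>\<infinity>n::int. exp (- of_real pi * of_int n ^ 2 * x))"

definition sigma3 :: "complex \<Rightarrow> complex"
  where "sigma3 z = 1 / csqrt (1 + z) * theta3 ((1 - z) / (1 + z))"

definition Omega :: real
  where "Omega = Gamma (1/4) ^ 8 / (32 * pi ^ 4)"

definition Phi :: real
  where "Phi = Omega / 4"

text \<open>The defining property of the integer sequence \<open>d\<close> (\<open>d 0 = 1\<close>, \<open>d 1 = 1\<close>, \<open>d 2 = -1\<close>,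
  \<open>d 3 = 51\<close>, ...).  It determines \<open>d\<close>: for \<open>n = 2 * m\<close> the summand with \<open>k = m\<close> is
  \<open>d m * Omega ^ m\<close>, and the other summands involve only earlier values of \<open>d\<close>.\<close>

definition theta3_deriv_sequence :: "(nat \<Rightarrow> int) \<Rightarrow> bool"
  where "theta3_deriv_sequence d \<longleftrightarrow>
    (\<forall>n. (deriv ^^ n) theta3 1 =
      theta3 1 * ((-1) ^ n / 4 ^ n) *
        (\<Sum>k = 0..n div 2.
           fact (2 * n) / (2 ^ (n - 2 * k) * fact (4 * k) * fact (n - 2 * k)) *
             of_int (d k) * of_real Omega ^ k))"

end

theory Submission imports Defs
begin

text \<open>Put \<open>x = (1 - z)/(1 + z)\<close>, so that \<open>x - 1 = -2z/(1 + z)\<close>. Substituting the Taylor series of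
  \<open>theta3\<close> at 1 turns its \<open>n\<close>-th term into a multiple of \<open>z ^ n * (1 + z) powr (-n - 1/2)\<close>. By the
  defining property of \<open>d\<close> the part containing \<open>d k\<close> is, with \<open>a = 2 * k + 1/2\<close>, proportional to
  \<open>z ^ (2 * k) * (1 + z) powr (-a) * (\<Sum>m. pochhammer a m / fact m * (z / (1 + z)) ^ m)\<close>. The sum over
  \<open>m\<close> is \<open>(1 - z / (1 + z)) powr (-a) = (1 + z) powr a\<close>, so only \<open>z ^ (2 * k)\<close> survives. The argument
  is carried out on Taylor coefficients, where all sums are finite; convergence on the unit disk
  follows from \<open>sigma3\<close> being holomorphic there.\<close>

section \<open>The theta series: convergence, holomorphy, value at 1\<close>

lemma summable_on_int_even:
  fixes f :: "int \<Rightarrow> real"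
  assumes "f summable_on range int" and even: "\<And>n. f (- n) = f n"
  shows "f summable_on UNIV"
proof -
  have "(f \<circ> uminus) summable_on range int"
    using assms by (simp add: o_def)
  hence "f summable_on uminus ` range int"
    by (subst summable_on_reindex) auto
  with assms(1) have "f summable_on (range int \<union> uminus ` range int)"
    by (rule summable_on_union)
  also have "range int \<union> uminus ` range int = UNIV"
    by (auto simp: image_iff) (metis int_cases2)
  finally show ?thesis .
qed

text \<open>Since \<open>n \<le> n ^ 2\<close> for natural \<open>n\<close>, the terms are dominated
  by a geometric series; evenness in \<open>n\<close> covers the negative integers.\<close>

lemma gaussian_summable_on_int:
  fixes c :: real
  assumes "c > 0"
  shows "(\<lambda>n::int. exp (- c * of_int n ^ 2)) summable_on UNIV"
proof (rule summable_on_int_even)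
  have "summable (\<lambda>n::nat. exp (- c) ^ n)"
    using assms by (intro summable_geometric) auto
  moreover have "norm (exp (- c * real n ^ 2)) \<le> exp (- c) ^ n" for n
  proof -
    have "real n \<le> real n ^ 2"
      by (cases n) (auto simp: power2_eq_square)
    thus ?thesis
      using assms by (simp flip: exp_of_nat_mult add: mult.commute)
  qed
  ultimately have "summable (\<lambda>n::nat. norm (exp (- c * real n ^ 2)))"
    by (intro summable_comparison_test[of "\<lambda>n. norm (exp (- c * real n ^ 2))" "\<lambda>n. exp (- c) ^ n"]) auto
  hence "(\<lambda>n::nat. exp (- c * real n ^ 2)) summable_on UNIV"
    by (rule norm_summable_imp_summable_on)
  thus "(\<lambda>n::int. exp (- c * of_int n ^ 2)) summable_on range int"
    by (subst summable_on_reindex) (auto simp: o_def)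
qed auto

text \<open>Holomorphy is local. Near \<open>x\<close> the real part stays above
  \<open>Re x / 2\<close>, so a Gaussian series majorizes the terms and the partial sums converge
  uniformly.\<close>

lemma theta3_holomorphic: "theta3 holomorphic_on {x. Re x > 0}"
proof -
  define f :: "int \<Rightarrow> complex \<Rightarrow> complex"
    where "f n x = exp (- of_real pi * of_int n ^ 2 * x)" for n x
  have "theta3 field_differentiable at x" if x: "Re x > 0" for x
  proof -
    define r where "r = Re x / 2"
    have r: "r > 0" using x by (simp add: r_def)
    have Re: "Re y \<ge> r" if "y \<in> cball x r" for y
    proof -
      have "\<bar>Re (x - y)\<bar> \<le> r"
        using abs_Re_le_cmod[of "x - y"] that by (simp add: dist_norm)
      thus ?thesis by (simp add: r_def abs_if split: if_splits)
    qed
    have bound: "norm (f n y) \<le> exp (- (pi * r) * of_int n ^ 2)" if "y \<in> cball x r" for n y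
    proof -
      have eq: "- complex_of_real pi * of_int n ^ 2 * y = of_real (- pi * of_int n ^ 2) * y"
        by simp
      have "norm (f n y) = exp (- pi * of_int n ^ 2 * Re y)"
        unfolding f_def eq norm_exp_eq_Re by simp
      moreover have "pi * of_int n ^ 2 * r \<le> pi * of_int n ^ 2 * Re y"
        using Re[OF that] by (intro mult_left_mono) auto
      ultimately show ?thesis by (simp add: mult_ac)
    qed
    have "uniform_limit (cball x r) (\<lambda>X y. \<Sum>n\<in>X. f n y) (\<lambda>y. \<Sum>\<^sub>\<infinity>n\<in>UNIV. f n y)
            (finite_subsets_at_top UNIV)"
      using bound gaussian_summable_on_int[of "pi * r"] r
      by (intro Weierstrass_m_test_general) auto
    also have "(\<lambda>y. \<Sum>\<^sub>\<infinity>n\<in>UNIV. f n y) = theta3"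
      by (simp add: f_def theta3_def fun_eq_iff)
    finally have "uniform_limit (cball x r) (\<lambda>X y. \<Sum>n\<in>X. f n y) theta3
                    (finite_subsets_at_top UNIV)" .
    moreover have "\<forall>\<^sub>F X in finite_subsets_at_top UNIV.
        continuous_on (cball x r) (\<lambda>y. \<Sum>n\<in>X. f n y) \<and>
        (\<lambda>y. \<Sum>n\<in>X. f n y) holomorphic_on ball x r"
      unfolding f_def
      by (intro always_eventually allI conjI holomorphic_intros continuous_intros)
    ultimately have "theta3 holomorphic_on ball x r"
      using holomorphic_uniform_limit[of x r "\<lambda>X y. \<Sum>n\<in>X. f n y" "finite_subsets_at_top UNIV" theta3]
      by auto
    thus ?thesis
      using r by (auto simp: holomorphic_on_open field_differentiable_def)
  qed
  thus ?thesis
    by (auto simp: holomorphic_on_def intro: field_differentiable_at_within)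
qed

text \<open>The terms at 1 are positive reals and the one with \<open>n = 0\<close> equals 1. This
  permits cancelling \<open>theta3 1\<close> in the final series.\<close>

lemma theta3_one_nonzero: "theta3 1 \<noteq> 0"
proof -
  let ?g = "\<lambda>n::int. exp (- pi * of_int n ^ 2)"
  have "sum ?g {0} \<le> infsum ?g UNIV"
    using gaussian_summable_on_int[of pi] by (intro finite_sum_le_infsum) auto
  moreover have "theta3 1 = of_real (infsum ?g UNIV)"
  proof -
    have "(?g has_sum infsum ?g UNIV) UNIV"
      using gaussian_summable_on_int[of pi] by (intro has_sum_infsum) simp
    hence "((\<lambda>n. complex_of_real (?g n)) has_sum of_real (infsum ?g UNIV)) UNIV"
      by (rule has_sum_of_real)
    moreover have "complex_of_real (?g n) = exp (- of_real pi * of_int n ^ 2 * 1)" for n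
      by (simp flip: exp_of_real)
    ultimately show ?thesis
      unfolding theta3_def by (simp add: infsumI)
  qed
  ultimately show ?thesis by auto
qed

section \<open>The Cayley transform and the local expansion of \<open>sigma3\<close>\<close>

text \<open>The real part equals \<open>(1 - norm z ^ 2) / norm (1 + z) ^ 2\<close>.\<close>

lemma Re_cayley_pos:
  assumes "norm (z::complex) < 1"
  shows "Re ((1 - z) / (1 + z)) > 0"
proof -
  have "(Re z)\<^sup>2 + (Im z)\<^sup>2 < 1"
    using assms by (simp add: cmod_def)
  moreover have "z \<noteq> -1" using assms by auto
  hence "1 + z \<noteq> 0" by (metis add_eq_0_iff)
  hence "(1 + Re z)\<^sup>2 + (Im z)\<^sup>2 > 0"
    by (auto simp: complex_eq_iff sum_power2_gt_zero_iff)
  ultimately show ?thesis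
    by (auto simp: Re_divide power2_eq_square algebra_simps intro!: divide_pos_pos)
qed

text \<open>Keeps \<open>1 + z\<close> away from the pole of the Cayley transform and from the
  branch cut of \<open>csqrt\<close>.\<close>

lemma one_plus_unit_disk:
  assumes "norm (z::complex) < 1"
  shows "1 + z \<noteq> 0" "1 + z \<notin> \<real>\<^sub>\<le>\<^sub>0"
proof -
  have "\<bar>Re z\<bar> < 1"
    using abs_Re_le_cmod[of z] assms by linarith
  thus "1 + z \<notin> \<real>\<^sub>\<le>\<^sub>0" by (auto simp: complex_nonpos_Reals_iff)
  thus "1 + z \<noteq> 0" by auto
qed

lemma sigma3_holomorphic: "sigma3 holomorphic_on ball 0 1"
proof -
  have "(\<lambda>z. theta3 ((1 - z) / (1 + z))) holomorphic_on ball 0 1"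
    by (rule holomorphic_on_compose_gen[OF _ theta3_holomorphic, unfolded o_def])
       (use Re_cayley_pos one_plus_unit_disk in \<open>auto intro!: holomorphic_intros\<close>)
  moreover have "(\<lambda>z. 1 / csqrt (1 + z)) holomorphic_on ball 0 1"
    by (intro holomorphic_intros) (use one_plus_unit_disk in auto)
  ultimately show ?thesis
    unfolding sigma3_def by (rule holomorphic_on_mult[rotated])
qed

lemma sigma3_has_fps_expansion:
  "sigma3 has_fps_expansion
     fps_binomial (-1/2) * (fps_expansion theta3 1 oo (fps_const (-2) * fps_X * fps_binomial (-1)))"
proof -
  define G :: "complex fps" where "G = fps_const (-2) * fps_X * fps_binomial (-1)"
  have "theta3 analytic_on {1}"
    using theta3_holomorphic
    by (auto simp: analytic_at intro!: exI[of _ "{x. Re x > 0}"] open_halfspace_Re_gt)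
  hence T: "(\<lambda>x. theta3 (1 + x)) has_fps_expansion fps_expansion theta3 1"
    by (rule analytic_at_imp_has_fps_expansion)
  have G: "(\<lambda>z. -2 * z * (1 + z) powr (-1)) has_fps_expansion G"
    unfolding G_def by (intro fps_expansion_intros)
  have "(\<lambda>z. (1 + z) powr (-1/2) *
            ((\<lambda>x. theta3 (1 + x)) \<circ> (\<lambda>z. -2 * z * (1 + z) powr (-1))) z)
          has_fps_expansion fps_binomial (-1/2) * (fps_expansion theta3 1 oo G)"
    by (intro has_fps_expansion_mult has_fps_expansion_binomial_complex
              has_fps_expansion_compose T G) (simp add: G_def)
  \<comment> \<open>An expansion at 0 depends only on the germ, so agreement with
    \<open>sigma3\<close> on the unit disk is enough.\<close>
  moreover have "\<forall>\<^sub>F z in nhds 0. (1 + z) powr (-1/2) *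
        ((\<lambda>x. theta3 (1 + x)) \<circ> (\<lambda>z. -2 * z * (1 + z) powr (-1))) z = sigma3 z"
  proof -
    have "\<forall>\<^sub>F z in nhds (0::complex). z \<in> ball 0 1"
      by (intro eventually_nhds_in_open) auto
    thus ?thesis
    proof eventually_elim
      case (elim z)
      hence z: "1 + z \<noteq> 0" using one_plus_unit_disk by auto
      have "(1 + z) powr (-1/2) = 1 / csqrt (1 + z)"
        using z exp_minus[of "Ln (1 + z) / 2"]
        by (simp add: csqrt_exp_Ln powr_def inverse_eq_divide)
      moreover have "1 + -2 * z * (1 + z) powr (-1) = (1 - z) / (1 + z)"
        using z by (simp add: powr_minus_divide field_simps)
      ultimately show ?case by (simp add: sigma3_def)
    qed
  qed
  ultimately show ?thesis
    unfolding G_def by (subst (asm) has_fps_expansion_cong[OF _ refl])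
qed

section \<open>Coefficient extraction and finite binomial sums\<close>

lemma fps_nth_mult_compose:
  fixes B T G :: "'a :: idom fps"
  assumes "fps_nth G 0 = 0"
  shows "fps_nth (B * (T oo G)) N = (\<Sum>n\<le>N. fps_nth T n * fps_nth (B * G ^ n) N)"
proof -
  \<comment> \<open>\<open>G ^ n\<close> starts in degree \<open>n\<close> or higher, so the sum may
    run up to \<open>N\<close> instead of \<open>N - i\<close>; the common range allows the later
    swap.\<close>
  have "fps_nth (T oo G) (N - i) = (\<Sum>n\<le>N. fps_nth T n * fps_nth (G ^ n) (N - i))" for i
    unfolding fps_compose_nth using assms
    by (intro sum.mono_neutral_left) (auto simp: startsby_zero_power_prefix)
  hence "fps_nth (B * (T oo G)) N =
          (\<Sum>i\<le>N. \<Sum>n\<le>N. fps_nth B i * (fps_nth T n * fps_nth (G ^ n) (N - i)))"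
    by (simp add: fps_mult_nth sum_distrib_left atMost_atLeast0)
  also have "\<dots> = (\<Sum>n\<le>N. fps_nth T n * fps_nth (B * G ^ n) N)"
    by (subst sum.swap) (simp add: fps_mult_nth sum_distrib_left atMost_atLeast0 mult_ac)
  finally show ?thesis .
qed

text \<open>The \<open>n\<close>-th power of the inner series is
  \<open>(-2) ^ n * X ^ n * (1 + X) powr (-n)\<close>; multiplying by
  \<open>(1 + X) powr (-1/2)\<close> leaves a binomial series shifted by \<open>n\<close>.\<close>

lemma fps_nth_sigma3:
  "fps_nth (fps_binomial (-1/2) *
      (T oo (fps_const (-2) * fps_X * fps_binomial (-1)))) N =
   (\<Sum>n\<le>N. fps_nth T n * (-2) ^ n * ((- of_nat n - 1/2 :: complex) gchoose (N - n)))"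
proof -
  have "fps_nth (fps_binomial (-1/2 :: complex) * (fps_const (-2) * fps_X * fps_binomial (-1)) ^ n) N =
          (-2) ^ n * ((- of_nat n - 1/2) gchoose (N - n))" if "n \<le> N" for n
  proof -
    have "fps_binomial (-1/2 :: complex) * (fps_const (-2) * fps_X * fps_binomial (-1)) ^ n =
            fps_const ((-2) ^ n) * (fps_X ^ n * (fps_binomial (-1/2) * fps_binomial (- of_nat n)))"
      by (simp add: power_mult_distrib fps_binomial_power fps_const_power mult_ac)
    also have "fps_binomial (-1/2) * fps_binomial (- of_nat n) =
                 fps_binomial (- of_nat n - 1/2 :: complex)"
      by (simp add: add.commute flip: fps_binomial_add_mult)
    finally show ?thesis
      using that by (simp add: fps_X_power_mult_nth del: fps_const_power)
  qed
  thus ?thesis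
    by (subst fps_nth_mult_compose) (auto simp: mult.assoc)
qed

text \<open>The coefficient form of \<open>(1 + z) powr (-a) * (1 - z / (1 + z)) powr (-a) = 1\<close>.\<close>

lemma sum_pochhammer_gbinomial:
  fixes a :: "'a :: field_char_0"
  shows "(\<Sum>m\<le>M. pochhammer a m / fact m * ((- a - of_nat m) gchoose (M - m))) =
           (if M = 0 then 1 else 0)"
proof (cases "M = 0")
  case False
  \<comment> \<open>The two rising factorials merge into \<open>pochhammer a M\<close>, which is
    free of \<open>m\<close>. What remains is the alternating sum over a row of Pascal's triangle,
    zero for \<open>M > 0\<close>.\<close>
  have "pochhammer a m / fact m * ((- a - of_nat m) gchoose (M - m)) =
          (-1) ^ M * pochhammer a M / fact M * ((-1) ^ m * of_nat (M choose m))"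
    if "m \<le> M" for m
  proof -
    have "pochhammer a m / fact m * ((- a - of_nat m) gchoose (M - m)) =
            (-1) ^ (M - m) * (pochhammer a m * pochhammer (a + of_nat m) (M - m))
              / (fact m * fact (M - m))"
      by (simp add: gbinomial_pochhammer add.commute)
    also have "pochhammer a m * pochhammer (a + of_nat m) (M - m) = pochhammer a M"
      using that by (simp add: pochhammer_product)
    also have "(-1 :: 'a) ^ (M - m) = (-1) ^ M * (-1) ^ m"
      using that by (auto simp: minus_one_power_iff)
    finally show ?thesis
      using that by (simp add: binomial_fact)
  qed
  hence "(\<Sum>m\<le>M. pochhammer a m / fact m * ((- a - of_nat m) gchoose (M - m))) =
           (-1) ^ M * pochhammer a M / fact M * (\<Sum>m\<le>M. (-1) ^ m * of_nat (M choose m))"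
    by (simp add: sum_distrib_left)
  with False show ?thesis
    by (simp add: choose_alternating_sum)
qed auto

text \<open>After exchanging the sums, fixed \<open>k\<close> and \<open>n = m + 2 * k\<close> give
  the preceding identity with \<open>a = 2 * k + 1/2\<close> and \<open>M = N - 2 * k\<close>, so
  only \<open>2 * k = N\<close> contributes.\<close>

lemma sum_triangle_pochhammer_gbinomial:
  fixes e :: "nat \<Rightarrow> 'a :: field_char_0"
  shows "(\<Sum>n\<le>N. (\<Sum>k\<le>n div 2. e k * (pochhammer (2 * of_nat k + 1/2) (n - 2 * k) / fact (n - 2 * k)))
            * ((- of_nat n - 1/2) gchoose (N - n)))
         = (if even N then e (N div 2) else 0)"
proof -
  define t where "t k n = e k * (pochhammer (2 * of_nat k + 1/2) (n - 2 * k) / fact (n - 2 * k))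
                  * ((- of_nat n - 1/2) gchoose (N - n))" for k n
  have inner: "(\<Sum>n\<in>{2*k..N}. t k n) = (if 2 * k = N then e k else 0)" if "2 * k \<le> N" for k
  proof -
    let ?a = "2 * of_nat k + 1/2 :: 'a"
    have shift: "- of_nat (m + 2 * k) - 1/2 = - ?a - of_nat m" for m
      by simp
    have "(\<Sum>n\<in>{2*k..N}. t k n) = (\<Sum>m\<le>N - 2 * k. t k (m + 2 * k))"
      using that
      by (intro sum.reindex_bij_witness[of _ "\<lambda>m. m + 2 * k" "\<lambda>n. n - 2 * k"]) auto
    also have "\<dots> = e k * (\<Sum>m\<le>N - 2 * k. pochhammer ?a m / fact m *
                        ((- ?a - of_nat m) gchoose (N - 2 * k - m)))"
      unfolding sum_distrib_left t_def
      by (intro sum.cong refl) (simp only: shift, simp add: diff_diff_eq add.commute mult.assoc)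
    finally show ?thesis
      using that unfolding sum_pochhammer_gbinomial by auto
  qed
  have "(\<Sum>n\<le>N. (\<Sum>k\<le>n div 2. e k * (pochhammer (2 * of_nat k + 1/2) (n - 2 * k) / fact (n - 2 * k)))
            * ((- of_nat n - 1/2) gchoose (N - n))) = (\<Sum>n\<le>N. \<Sum>k\<le>n div 2. t k n)"
    by (simp add: t_def sum_distrib_right)
  \<comment> \<open>Both sides range over the pairs with
    \<open>2 * k \<le> n \<le> N\<close>.\<close>
  also have "\<dots> = (\<Sum>k\<le>N div 2. \<Sum>n\<in>{2*k..N}. t k n)"
    unfolding sum.Sigma[OF finite_atMost ballI[OF finite_atMost]]
              sum.Sigma[OF finite_atMost ballI[OF finite_atLeastAtMost]]
    by (intro sum.reindex_bij_witness[of _ prod.swap prod.swap]) auto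
  also have "\<dots> = (\<Sum>k\<le>N div 2. if 2 * k = N then e k else 0)"
    by (intro sum.cong refl inner) auto
  also have "\<dots> = (if even N then e (N div 2) else 0)"
  proof (cases "even N")
    case True
    hence "(2 * k = N) = (k = N div 2)" for k by auto
    with True show ?thesis by simp
  next
    case False
    hence "2 * k \<noteq> N" for k by auto
    with False show ?thesis by simp
  qed
  finally show ?thesis .
qed

section \<open>Inserting the sequence \<open>d\<close> and summing the series\<close>

text \<open>The duplication formula
  \<open>fact (2 * j) = 4 ^ j * pochhammer (1/2) j * fact j\<close>, used for
  \<open>j = 2 * k\<close> and \<open>j = n\<close>, leaves the quotient of
  \<open>pochhammer (1/2) n\<close> by \<open>pochhammer (1/2) (2 * k)\<close>, which is the shifted
  rising factorial. The surplus factor \<open>1 / 4 ^ k\<close> turns \<open>Omega\<close> into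
  \<open>Phi\<close>.\<close>

lemma theta3_taylor_coeff_summand:
  assumes "2 * k \<le> n"
  shows "(-2) ^ n * ((-1) ^ n / 4 ^ n) / fact n *
           (fact (2 * n) / (2 ^ (n - 2 * k) * fact (4 * k) * fact (n - 2 * k)) * (c * of_real Omega ^ k))
         = c * of_real Phi ^ k / fact (2 * k) *
           (pochhammer (2 * of_nat k + 1/2 :: complex) (n - 2 * k) / fact (n - 2 * k))"
proof -
  define m where "m = n - 2 * k"
  have n: "n = 2 * k + m" using assms by (simp add: m_def)
  have k4: "(fact (4 * k) :: complex) = 4 ^ (2 * k) * pochhammer (1/2) (2 * k) * fact (2 * k)"
    using fact_double[of "2 * k", where 'a = complex] by (simp add: power_mult)
  have n2: "(fact (2 * n) :: complex) =
              4 ^ n * (pochhammer (1/2) (2 * k) * pochhammer (2 * of_nat k + 1/2) m) * fact n"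
    using fact_double[of n, where 'a = complex] pochhammer_product'[of "1/2 :: complex" "2 * k" m]
    by (simp add: power_mult power_add add.commute n)
  \<comment> \<open>Otherwise \<open>k4\<close> would make \<open>fact (4 * k)\<close> zero.\<close>
  have nz: "pochhammer (1/2 :: complex) (2 * k) \<noteq> 0"
    using k4 by (metis fact_nonzero mult_zero_left mult_zero_right)
  have sgn: "(-2 :: complex) ^ n * (-1) ^ n = 2 ^ n"
    by (simp flip: power_mult_distrib)
  have pw: "(2 :: complex) ^ n = 4 ^ k * 2 ^ m"
    by (simp add: n power_add power_mult)
  have four: "(4 :: complex) ^ (2 * k) = 4 ^ k * 4 ^ k"
    by (simp flip: power_add mult_2)
  have "(-2) ^ n * ((-1) ^ n / 4 ^ n) / fact n *
           (fact (2 * n) / (2 ^ m * fact (4 * k) * fact m) * (c * of_real Omega ^ k))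
        = ((-2) ^ n * (-1) ^ n) / 2 ^ m / 4 ^ (2 * k) * c * of_real Omega ^ k / fact (2 * k) *
          (pochhammer (2 * of_nat k + 1/2) m / fact m)"
    unfolding k4 n2 using nz by (simp add: field_simps)
  also have "\<dots> = c * (of_real Omega ^ k / 4 ^ k) / fact (2 * k) *
          (pochhammer (2 * of_nat k + 1/2) m / fact m)"
    unfolding sgn pw four by simp
  also have "of_real Omega ^ k / 4 ^ k = (of_real Phi ^ k :: complex)"
    by (simp add: Phi_def power_divide)
  finally show ?thesis by (simp add: m_def)
qed

lemma fps_expansion_sigma3_nth:
  assumes "theta3_deriv_sequence d"
  shows "(deriv ^^ N) sigma3 0 / fact N =
           (if even N then theta3 1 * (of_int (d (N div 2)) * of_real Phi ^ (N div 2) / fact N) else 0)"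
proof -
  define e :: "nat \<Rightarrow> complex"
    where "e k = theta3 1 * (of_int (d k) * of_real Phi ^ k / fact (2 * k))" for k
  have coeff: "fps_nth (fps_expansion theta3 1) n * (-2) ^ n =
      (\<Sum>k\<le>n div 2. e k * (pochhammer (2 * of_nat k + 1/2) (n - 2 * k) / fact (n - 2 * k)))" for n
  proof -
    have "fps_nth (fps_expansion theta3 1) n * (-2) ^ n =
       theta3 1 * (\<Sum>k\<le>n div 2. (-2) ^ n * ((-1) ^ n / 4 ^ n) / fact n *
         (fact (2 * n) / (2 ^ (n - 2 * k) * fact (4 * k) * fact (n - 2 * k)) *
           (of_int (d k) * of_real Omega ^ k)))"
      using assms unfolding theta3_deriv_sequence_def
      by (simp add: fps_expansion_def sum_distrib_left sum_divide_distrib atMost_atLeast0 mult_ac)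
    also have "(\<Sum>k\<le>n div 2. (-2) ^ n * ((-1) ^ n / 4 ^ n) / fact n *
         (fact (2 * n) / (2 ^ (n - 2 * k) * fact (4 * k) * fact (n - 2 * k)) *
           (of_int (d k) * of_real Omega ^ k))) =
       (\<Sum>k\<le>n div 2. of_int (d k) * of_real Phi ^ k / fact (2 * k) *
           (pochhammer (2 * of_nat k + 1/2 :: complex) (n - 2 * k) / fact (n - 2 * k)))"
      by (intro sum.cong refl theta3_taylor_coeff_summand) auto
    finally show ?thesis
      by (simp add: e_def sum_distrib_left mult.assoc)
  qed
  have "(deriv ^^ N) sigma3 0 / fact N =
          (\<Sum>n\<le>N. fps_nth (fps_expansion theta3 1) n * (-2) ^ n * ((- of_nat n - 1/2) gchoose (N - n)))"
    unfolding fps_nth_fps_expansion[OF sigma3_has_fps_expansion, symmetric]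
    by (rule fps_nth_sigma3)
  also have "\<dots> = (if even N then e (N div 2) else 0)"
    unfolding coeff by (rule sum_triangle_pochhammer_gbinomial)
  finally show ?thesis by (simp add: e_def)
qed

theorem theorem2:
  fixes d :: "nat \<Rightarrow> int" and z :: complex
  assumes d: "theta3_deriv_sequence d"
    and z: "norm z < 1"
  shows "summable (\<lambda>n. of_int (d n) / fact (2 * n) * of_real Phi ^ n * z ^ (2 * n))
    \<and> sigma3 z =
        theta3 1 * (\<Sum>n. of_int (d n) / fact (2 * n) * of_real Phi ^ n * z ^ (2 * n))"
proof -
  define a where "a n = of_int (d n) / fact (2 * n) * of_real Phi ^ n * z ^ (2 * n)" for n
  define b where "b N = (deriv ^^ N) sigma3 0 / fact N * (z - 0) ^ N" for N
  have "b sums sigma3 z"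
    unfolding b_def using sigma3_holomorphic z by (intro holomorphic_power_series) auto
  \<comment> \<open>The odd coefficients vanish, so the power series can be reindexed along the even
    exponents.\<close>
  moreover have "b N = 0" if "N \<notin> range (\<lambda>n. 2 * n)" for N
    using that by (auto simp: b_def fps_expansion_sigma3_nth[OF d] elim!: evenE)
  ultimately have "(\<lambda>n. b (2 * n)) sums sigma3 z"
    using sums_mono_reindex[of "\<lambda>n. 2 * n" b "sigma3 z"] by (auto simp: strict_mono_def)
  also have "(\<lambda>n. b (2 * n)) = (\<lambda>n. theta3 1 * a n)"
    by (simp add: fun_eq_iff a_def b_def fps_expansion_sigma3_nth[OF d])
  finally have sums: "(\<lambda>n. theta3 1 * a n) sums sigma3 z" .
  hence "summable (\<lambda>n. theta3 1 * a n)"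
    by (rule sums_summable)
  hence "summable a"
    by (rule summable_mult_D) (rule theta3_one_nonzero)
  moreover from this have "sigma3 z = theta3 1 * (\<Sum>n. a n)"
    using sums by (simp add: sums_iff suminf_mult)
  ultimately show ?thesis
    unfolding a_def by blast
qed

end
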